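(* Let $I\colon\mathbb{R}^d\to\mathbb{R}$ be a conserved quantity of the stochastic differential equation $$\mathrm dX(t)=S(X)\nabla I(X)\,\mathrm dt+\sum_{r=1}^{m}T_r(X)\nabla I(X)\circ\mathrm dW_r(t),$$ where $S(x),T_r(x)\in\mathbb{R}^{d\times d}$ ($r=1,\dots,m$) are skew-symmetric matrices for every $x$. Then the numerical method $$\bar X_{n+1}=\bar X_n+hS\Bigl(\tfrac{\bar X_n+\bar X_{n+1}}{2}\Bigr)\int_0^1\nabla I(\bar X_n+\tau(\bar X_{n+1}-\bar X_n))\,\mathrm d\tau+\sum_{r=1}^m\Delta\hat W_r\,T_r\Bigl(\tfrac{\bar X_n+\bar X_{n+1}}{2}\Bigr)\int_0^1\nabla I(\bar X_n+\tau(\bar X_{n+1}-\bar X_n))\,\mathrm d\tau$$ exactly preserves the invariant, i.e. $I(\bar X_n)=I(\bar X_{n+1})$ for all $n\ge 0$.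
   Context: $W_1,\dots,W_m$ are independent one-dimensional Brownian motions and $\circ$ denotes the Stratonovich differential. $I$ is (at least) continuously differentiable; functions $S,T_r,I$ are sufficiently smooth. $h>0$ is a fixed step size, and the method is implicit: $\bar X_{n+1}$ denotes a solution of the displayed equation. In step $n$, $\Delta\hat W_r=\sqrt h\,\zeta_h^r$, where $\zeta_h^r$ is the truncation of a standard normal variable $\xi^r$ (with $\sqrt h\,\xi^r=\Delta W_r$ the Brownian increment over the step): $\zeta_h^r=\xi^r$ if $|\xi^r|\le A_h$, $\zeta_h^r=A_h$ if $\xi^r>A_h$, $\zeta_h^r=-A_h$ if $\xi^r<-A_h$, with $A_h=\sqrt{4|\ln h|}$. *)

theory Defs
  imports "HOL-Probability.Probability"
begin

section \<open>Brownian motion\<close>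

definition brownian_motion :: "'w measure \<Rightarrow> (real \<Rightarrow> 'w \<Rightarrow> real) \<Rightarrow> bool" where
  "brownian_motion M B \<longleftrightarrow>
     prob_space M \<and>
     (\<forall>t\<ge>0. B t \<in> borel_measurable M) \<and>
     (AE \<omega> in M. B 0 \<omega> = 0) \<and>
     (AE \<omega> in M. continuous_on {0..} (\<lambda>t. B t \<omega>)) \<and>
     (\<forall>s t. 0 \<le> s \<and> s < t \<longrightarrow>
        distributed M lborel (\<lambda>\<omega>. B t \<omega> - B s \<omega>) (normal_density 0 (sqrt (t - s)))) \<and>
     (\<forall>p n. 0 \<le> p 0 \<and> strict_mono p \<longrightarrow>
        prob_space.indep_vars M (\<lambda>_. borel) (\<lambda>i \<omega>. B (p (Suc i)) \<omega> - B (p i) \<omega>) {..<n :: nat})"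

definition independent_brownian_motions ::
    "'w measure \<Rightarrow> nat \<Rightarrow> (nat \<Rightarrow> real \<Rightarrow> 'w \<Rightarrow> real) \<Rightarrow> bool" where
  "independent_brownian_motions M m W \<longleftrightarrow>
     prob_space M \<and>
     (\<forall>r\<in>{1..m}. brownian_motion M (W r)) \<and>
     prob_space.indep_vars M (\<lambda>_. Pi\<^sub>M {0..} (\<lambda>_. borel)) (\<lambda>r \<omega>. \<lambda>t\<in>{0..}. W r t \<omega>) {1..m}"

text \<open>The family \<open>F\<close> is a filtration to which the driving Brownian motions are adapted and from which
  their future increments are independent.  Only its members with index \<open>t \<ge> 0\<close> matter.\<close>

definition admissible_filtration ::
    "'w measure \<Rightarrow> nat \<Rightarrow> (nat \<Rightarrow> real \<Rightarrow> 'w \<Rightarrow> real) \<Rightarrow> (real \<Rightarrow> 'w measure) \<Rightarrow> bool" where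
  "admissible_filtration M m W F \<longleftrightarrow>
     filtration (space M) F \<and>
     (\<forall>t. subalgebra M (F t)) \<and>
     (\<forall>r\<in>{1..m}. \<forall>t\<ge>0. W r t \<in> borel_measurable (F t)) \<and>
     (\<forall>s t. 0 \<le> s \<and> s < t \<longrightarrow>
        prob_space.indep_set M (sets (F s))
          (sets (vimage_algebra (space M) (\<lambda>\<omega>. \<lambda>r\<in>{1..m}. W r t \<omega> - W r s \<omega>)
             (Pi\<^sub>M {1..m} (\<lambda>_. borel)))))"


section \<open>Stratonovich integrals\<close>

definition is_partition :: "real \<Rightarrow> nat \<Rightarrow> (nat \<Rightarrow> real) \<Rightarrow> bool" where
  "is_partition t n p \<longleftrightarrow> p 0 = 0 \<and> p n = t \<and> (\<forall>i<n. p i < p (Suc i))"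

text \<open>The random sums \<open>\<Sigma> n p\<close>, formed along partitions \<open>p\<close> of \<open>[0,t]\<close> into \<open>n\<close> pieces, converge in
  probability to \<open>Z\<close> as the mesh of \<open>p\<close> tends to zero.\<close>

definition mesh_limit_in_prob ::
    "'w measure \<Rightarrow> real \<Rightarrow> (nat \<Rightarrow> (nat \<Rightarrow> real) \<Rightarrow> 'w \<Rightarrow> 'b::euclidean_space) \<Rightarrow> ('w \<Rightarrow> 'b) \<Rightarrow> bool" where
  "mesh_limit_in_prob M t \<Sigma> Z \<longleftrightarrow>
     Z \<in> borel_measurable M \<and>
     (\<forall>\<epsilon>>0. \<exists>\<delta>>0. \<forall>n p. is_partition t n p \<and> (\<forall>i<n. p (Suc i) - p i < \<delta>) \<longrightarrow>
        measure M {\<omega> \<in> space M. dist (\<Sigma> n p \<omega>) (Z \<omega>) > \<epsilon>} < \<epsilon>)"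

definition has_ito_integral ::
    "'w measure \<Rightarrow> (real \<Rightarrow> 'w \<Rightarrow> 'b::euclidean_space) \<Rightarrow> (real \<Rightarrow> 'w \<Rightarrow> real) \<Rightarrow> real \<Rightarrow> ('w \<Rightarrow> 'b) \<Rightarrow> bool" where
  "has_ito_integral M Y B t Z \<longleftrightarrow>
     (\<forall>s\<in>{0..t}. Y s \<in> borel_measurable M) \<and>
     mesh_limit_in_prob M t
       (\<lambda>n p \<omega>. \<Sum>i<n. (B (p (Suc i)) \<omega> - B (p i) \<omega>) *\<^sub>R Y (p i) \<omega>) Z"

definition has_covariation ::
    "'w measure \<Rightarrow> (real \<Rightarrow> 'w \<Rightarrow> 'b::euclidean_space) \<Rightarrow> (real \<Rightarrow> 'w \<Rightarrow> real) \<Rightarrow> real \<Rightarrow> ('w \<Rightarrow> 'b) \<Rightarrow> bool" where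
  "has_covariation M Y B t Z \<longleftrightarrow>
     (\<forall>s\<in>{0..t}. Y s \<in> borel_measurable M) \<and>
     mesh_limit_in_prob M t
       (\<lambda>n p \<omega>. \<Sum>i<n. (B (p (Suc i)) \<omega> - B (p i) \<omega>) *\<^sub>R (Y (p (Suc i)) \<omega> - Y (p i) \<omega>)) Z"

definition locally_bounded_variation :: "(real \<Rightarrow> 'b::real_normed_vector) \<Rightarrow> bool" where
  "locally_bounded_variation a \<longleftrightarrow>
     (\<forall>t\<ge>0. \<exists>C. \<forall>n p. is_partition t n p \<longrightarrow> (\<Sum>i<n. norm (a (p (Suc i)) - a (p i))) \<le> C)"

text \<open>\<open>\<integral> Y \<circ> dB = \<integral> Y dB + [Y, B] / 2\<close>, so that \<open>Z t\<close> is the limit in probability of the averaged sums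
  \<open>\<Sum> (Y (p i) + Y (p (i+1))) / 2 * (B (p (i+1)) - B (p i))\<close>.  As usual for Stratonovich integrals, the
  bracket \<open>[Y, B]\<close> is required to be a continuous process of locally bounded variation.  This makes
  the integral process of a continuous adapted integrand a continuous semimartingale.\<close>

definition stratonovich_integral ::
    "'w measure \<Rightarrow> (real \<Rightarrow> 'w \<Rightarrow> 'b::euclidean_space) \<Rightarrow> (real \<Rightarrow> 'w \<Rightarrow> real) \<Rightarrow> (real \<Rightarrow> 'w \<Rightarrow> 'b) \<Rightarrow> bool" where
  "stratonovich_integral M Y B Z \<longleftrightarrow>
     (\<exists>J K. (\<forall>t\<ge>0. has_ito_integral M Y B t (J t) \<and> has_covariation M Y B t (K t)) \<and>
        (\<forall>t\<ge>0. AE \<omega> in M. Z t \<omega> = J t \<omega> + (1 / 2) *\<^sub>R K t \<omega>) \<and>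
        (AE \<omega> in M. continuous_on {0..} (\<lambda>t. K t \<omega>) \<and> locally_bounded_variation (\<lambda>t. K t \<omega>)))"


section \<open>Stratonovich equations and conserved quantities\<close>

text \<open>\<open>X\<close> is a solution of \<open>dX = f(X) dt + \<Sum>r=1..m. g r (X) \<circ> dW r\<close>.\<close>

definition stratonovich_solution ::
    "'w measure \<Rightarrow> (real \<Rightarrow> 'w measure) \<Rightarrow> nat \<Rightarrow> (nat \<Rightarrow> real \<Rightarrow> 'w \<Rightarrow> real) \<Rightarrow>
     ('b::euclidean_space \<Rightarrow> 'b) \<Rightarrow> (nat \<Rightarrow> 'b \<Rightarrow> 'b) \<Rightarrow> (real \<Rightarrow> 'w \<Rightarrow> 'b) \<Rightarrow> bool" where
  "stratonovich_solution M F m W f g X \<longleftrightarrow>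
     (\<forall>t\<ge>0. X t \<in> borel_measurable (F t)) \<and>
     (AE \<omega> in M. continuous_on {0..} (\<lambda>t. X t \<omega>)) \<and>
     (\<exists>Z. (\<forall>r\<in>{1..m}. stratonovich_integral M (\<lambda>s \<omega>. g r (X s \<omega>)) (W r) (Z r)) \<and>
        (\<forall>t\<ge>0. AE \<omega> in M.
           set_integrable lborel {0..t} (\<lambda>s. f (X s \<omega>)) \<and>
           X t \<omega> = X 0 \<omega> + (LINT s:{0..t}|lborel. f (X s \<omega>)) + (\<Sum>r=1..m. Z r t \<omega>)))"

definition conserved_quantity ::
    "'w measure \<Rightarrow> nat \<Rightarrow> (nat \<Rightarrow> real \<Rightarrow> 'w \<Rightarrow> real) \<Rightarrow>
     ('b::euclidean_space \<Rightarrow> 'b) \<Rightarrow> (nat \<Rightarrow> 'b \<Rightarrow> 'b) \<Rightarrow> ('b \<Rightarrow> real) \<Rightarrow> bool" where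
  "conserved_quantity M m W f g I \<longleftrightarrow>
     (\<forall>F X. admissible_filtration M m W F \<and> stratonovich_solution M F m W f g X \<longrightarrow>
        (AE \<omega> in M. \<forall>t\<ge>0. I (X t \<omega>) = I (X 0 \<omega>)))"


section \<open>The numerical method\<close>

definition skew_symmetric :: "real ^ 'd ^ 'd \<Rightarrow> bool" where
  "skew_symmetric A \<longleftrightarrow> transpose A = - A"

definition truncate_at :: "real \<Rightarrow> real \<Rightarrow> real" where
  "truncate_at A \<xi> = (if \<bar>\<xi>\<bar> \<le> A then \<xi> else if \<xi> > A then A else - A)"

definition truncation_level :: "real \<Rightarrow> real" where
  "truncation_level h = sqrt (4 * \<bar>ln h\<bar>)"

text \<open>The truncated increment of the Brownian motion \<open>B\<close> over the step from \<open>n h\<close> to \<open>(n+1) h\<close>.\<close>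

definition truncated_increment :: "(real \<Rightarrow> 'w \<Rightarrow> real) \<Rightarrow> real \<Rightarrow> nat \<Rightarrow> 'w \<Rightarrow> real" where
  "truncated_increment B h n \<omega> =
     (let \<xi> = (B (real (Suc n) * h) \<omega> - B (real n * h) \<omega>) / sqrt h
      in sqrt h * truncate_at (truncation_level h) \<xi>)"

definition mean_along_segment ::
    "('b::euclidean_space \<Rightarrow> 'b) \<Rightarrow> 'b \<Rightarrow> 'b \<Rightarrow> 'b" where
  "mean_along_segment v x y = integral {0..1} (\<lambda>\<tau>. v (x + \<tau> *\<^sub>R (y - x)))"

text \<open>One step of the implicit method: \<open>y\<close> solves the defining equation for the starting value \<open>x\<close>,
  step size \<open>h\<close> and noise increments \<open>\<Delta> 1, \<dots>, \<Delta> m\<close>; \<open>v\<close> is the gradient field.\<close>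

definition method_step ::
    "nat \<Rightarrow> (real ^ 'd \<Rightarrow> real ^ 'd ^ 'd) \<Rightarrow> (nat \<Rightarrow> real ^ 'd \<Rightarrow> real ^ 'd ^ 'd) \<Rightarrow>
     (real ^ 'd \<Rightarrow> real ^ 'd) \<Rightarrow> real \<Rightarrow> (nat \<Rightarrow> real) \<Rightarrow> real ^ 'd \<Rightarrow> real ^ 'd \<Rightarrow> bool" where
  "method_step m S T v h \<Delta> x y \<longleftrightarrow>
     y = x + h *\<^sub>R (S ((1 / 2) *\<^sub>R (x + y)) *v mean_along_segment v x y)
           + (\<Sum>r=1..m. \<Delta> r *\<^sub>R (T r ((1 / 2) *\<^sub>R (x + y)) *v mean_along_segment v x y))"

end

theory Submission
  imports Defs
begin

text \<open>Conservation holds pathwise, separately in every step, and is an algebraic fact about the real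
  values that the noise increments take there.  Write \<open>v\<close> for the mean of the gradient along the
  segment from \<open>x\<close> to \<open>y\<close>.  By the fundamental theorem of calculus this averaged gradient satisfies the
  discrete chain rule \<open>I y - I x = (y - x) \<bullet> v\<close> exactly (\<open>diff_eq_inner_mean_along_segment\<close>).  The
  increment \<open>y - x\<close> of the method is a linear combination of vectors \<open>A v\<close>, where \<open>A\<close> is one of the
  skew-symmetric matrices \<open>S\<close>, \<open>T r\<close> at the midpoint.  Each \<open>A v\<close> is orthogonal to \<open>v\<close>
  (\<open>skew_symmetric_inner_mult_self\<close>), hence so is the increment
  (\<open>method_step_increment_orthogonal\<close>), and \<open>I\<close> does not change.\<close>

lemma skew_symmetric_inner_mult_self:
  fixes A :: "real ^ 'd ^ 'd"
  assumes "skew_symmetric A"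
  shows "(A *v v) \<bullet> v = 0"
proof -
  have "(A *v v) \<bullet> v = v \<bullet> (transpose A *v v)"
    by (simp only: transpose_matrix_vector inner_commute[of v] dot_lmul_matrix)
  also have "transpose A *v v = - (A *v v)"
    using assms matrix_vector_mult_diff_rdistrib[of 0 A v] by (simp add: skew_symmetric_def)
  finally show ?thesis
    by (simp add: inner_commute)
qed

text \<open>Along the segment, \<open>\<tau> \<mapsto> I (x + \<tau> (y - x))\<close> has the derivative
  \<open>(y - x) \<bullet> g (x + \<tau> (y - x))\<close>.  Integrating over \<open>[0,1]\<close> and moving the constant factor \<open>y - x\<close> out
  of the integral gives the exact chain rule.  Continuity of the gradient guarantees
  that the vector-valued integral exists.\<close>

lemma diff_eq_inner_mean_along_segment:
  fixes I :: "'b::euclidean_space \<Rightarrow> real"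
  assumes deriv: "\<And>z. GDERIV I z :> g z" and cont: "continuous_on UNIV g"
  shows "I y - I x = (y - x) \<bullet> mean_along_segment g x y"
proof -
  let ?p = "\<lambda>\<tau>::real. x + \<tau> *\<^sub>R (y - x)"
  have "((\<lambda>\<tau>. (y - x) \<bullet> g (?p \<tau>)) has_integral I (?p 1) - I (?p 0)) {0..1}"
  proof (rule fundamental_theorem_of_calculus)
    fix \<tau> :: real
    have "(?p has_derivative (\<lambda>k. k *\<^sub>R (y - x))) (at \<tau> within {0..1})"
      by (auto intro!: derivative_eq_intros)
    moreover have "(I has_derivative (\<lambda>k. k \<bullet> g (?p \<tau>))) (at (?p \<tau>))"
      using deriv[of "?p \<tau>"] by (simp add: gderiv_def)
    ultimately have "((\<lambda>\<tau>. I (?p \<tau>)) has_derivative (\<lambda>k. (k *\<^sub>R (y - x)) \<bullet> g (?p \<tau>)))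
        (at \<tau> within {0..1})"
      by (rule has_derivative_compose)
    then show "((\<lambda>\<tau>. I (?p \<tau>)) has_vector_derivative (y - x) \<bullet> g (?p \<tau>)) (at \<tau> within {0..1})"
      by (simp add: has_vector_derivative_def)
  qed simp
  moreover have "((\<lambda>\<tau>. (y - x) \<bullet> g (?p \<tau>)) has_integral (y - x) \<bullet> mean_along_segment g x y) {0..1}"
  proof -
    have "continuous_on {0..1} (\<lambda>\<tau>. g (?p \<tau>))"
      by (rule continuous_on_compose2[OF cont]) (auto intro!: continuous_intros)
    then have "((\<lambda>\<tau>. g (?p \<tau>)) has_integral mean_along_segment g x y) {0..1}"
      unfolding mean_along_segment_def
      by (intro integrable_integral integrable_continuous_real)
    from has_integral_linear[OF this bounded_linear_inner_right[of "y - x"]] show ?thesis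
      by (simp add: o_def)
  qed
  ultimately show ?thesis
    by (auto dest: has_integral_unique)
qed

lemma method_step_increment_orthogonal:
  assumes step: "method_step m S T v h \<Delta> x y"
    and skew_S: "\<And>z. skew_symmetric (S z)"
    and skew_T: "\<And>r z. r \<in> {1..m} \<Longrightarrow> skew_symmetric (T r z)"
  shows "(y - x) \<bullet> mean_along_segment v x y = 0"
proof -
  let ?v = "mean_along_segment v x y" and ?c = "(1 / 2) *\<^sub>R (x + y)"
  have "y - x = h *\<^sub>R (S ?c *v ?v) + (\<Sum>r=1..m. \<Delta> r *\<^sub>R (T r ?c *v ?v))"
    using step unfolding method_step_def by (simp only: diff_eq_eq ac_simps)
  then have "(y - x) \<bullet> ?v = h * ((S ?c *v ?v) \<bullet> ?v) + (\<Sum>r=1..m. \<Delta> r * ((T r ?c *v ?v) \<bullet> ?v))"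
    by (simp only: inner_add_left inner_sum_left inner_scaleR_left)
  then show ?thesis
    by (simp add: skew_symmetric_inner_mult_self skew_S skew_T)
qed

theorem proposition3p1:
  fixes M :: "'w measure" and m :: nat and W :: "nat \<Rightarrow> real \<Rightarrow> 'w \<Rightarrow> real"
    and S :: "real ^ 'd \<Rightarrow> real ^ 'd ^ 'd" and T :: "nat \<Rightarrow> real ^ 'd \<Rightarrow> real ^ 'd ^ 'd"
    and I :: "real ^ 'd \<Rightarrow> real" and gradI :: "real ^ 'd \<Rightarrow> real ^ 'd"
    and h :: real and Xbar :: "nat \<Rightarrow> 'w \<Rightarrow> real ^ 'd" and \<omega> :: 'w
  assumes "independent_brownian_motions M m W"
    and "\<And>x. GDERIV I x :> gradI x"
    and "continuous_on UNIV gradI"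
    and "\<And>x. skew_symmetric (S x)"
    and "\<And>r x. r \<in> {1..m} \<Longrightarrow> skew_symmetric (T r x)"
    and "conserved_quantity M m W (\<lambda>x. S x *v gradI x) (\<lambda>r x. T r x *v gradI x) I"
    and "h > 0"
    and "\<omega> \<in> space M"
    and "\<And>n. method_step m S T gradI h (\<lambda>r. truncated_increment (W r) h n \<omega>)
               (Xbar n \<omega>) (Xbar (Suc n) \<omega>)"
  shows "\<forall>n. I (Xbar n \<omega>) = I (Xbar (Suc n) \<omega>)"
proof
  fix n
  have "I (Xbar (Suc n) \<omega>) - I (Xbar n \<omega>)
      = (Xbar (Suc n) \<omega> - Xbar n \<omega>) \<bullet> mean_along_segment gradI (Xbar n \<omega>) (Xbar (Suc n) \<omega>)"
    by (rule diff_eq_inner_mean_along_segment) (fact assms)+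
  also have "\<dots> = 0"
    by (rule method_step_increment_orthogonal) (fact assms)+
  finally show "I (Xbar n \<omega>) = I (Xbar (Suc n) \<omega>)"
    by simp
qed

end
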